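(* Let $N,d\ge1$ be integers, $T>0$, $\gamma\in(\frac1{N+1},\frac1N]$, and let $\mathbf X$ be a $\gamma$-Hölder branched rough path on $[0,T]$ over $\mathbb R^d$. Let $\tau$ be a nonempty tree with $|\tau|\le N$. If $\langle\mathbf X_t,\sigma\rangle=0$ for all $t\in[0,T]$ and all nonempty trees $\sigma$ with $|\sigma|\le\lfloor|\tau|/2\rfloor$, then there exists $f\in C^{\gamma|\tau|}([0,T],(\mathbb R^d)^{\otimes|\tau|})$ such that $\langle\mathbf X_{st},\tau\rangle=f(t)-f(s)$ for all $0\le s<t\le T$.
   Context: Trees and forests. $\mathcal T$ is the set of finite (non-planar) rooted trees with vertices labelled by $\{1,\dots,d\}$, together with the empty tree $\mathbf 1$; $\mathcal F$ is the set of forests, i.e. finite commutative products (repetitions allowed) of nonempty labelled trees, the empty product being $\mathbf 1$. $|f|$ is the number of vertices of $f$; $\mathcal F_n=\{f\in\mathcal F:|f|\le n\}$. $[f]_a$ is the tree obtained by joining the roots of all trees in $f$ to a new root labelled $a$. Hopf algebra. $\mathcal H$ is the real vector space with basis $\mathcal F$ and the commutative product of forests. The coproduct $\Delta$ is the algebra morphism with $\Delta\mathbf 1=\mathbf 1\otimes\mathbf 1$ and $\Delta[f]_a=[f]_a\otimes\mathbf 1+(\mathrm{id}\otimes[\cdot]_a)\Delta f$. For linear functionals $x,y$ on $\mathcal H$, $\langle x\star y,h\rangle=\langle x\otimes y,\Delta h\rangle$. $G_N$ is the group (under $\star$) of characters (unital real-valued algebra homomorphisms) of $\mathcal H$, modulo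 identification of characters agreeing on $\mathcal F_N$. Branched rough path. A $\gamma$-Hölder branched rough path is a map $\mathbf X:[0,T]\to G_N$ such that, with $\mathbf X_{st}:=\mathbf X_s^{-1}\star\mathbf X_t$, $\sup_{0\le s<t\le T}|\langle\mathbf X_{st},f\rangle|/|t-s|^{\gamma|f|}<\infty$ for all $f\in\mathcal F_N$. Tensor notation. In the claim $\tau$ is a tree shape (unlabelled rooted tree with a fixed enumeration of its vertices), and $\langle\mathbf X_{st},\tau\rangle\in(\mathbb R^d)^{\otimes|\tau|}$ is the tensor whose $(a_1,\dots,a_{|\tau|})$-coordinate is $\langle\mathbf X_{st},\tau_{a_1\dots a_{|\tau|}}\rangle$, where $\tau_{a_1\dots a_{|\tau|}}$ is $\tau$ with its $i$-th vertex labelled $a_i$. The hypothesis on $\sigma$ is for all labelled trees of the given size. $C^\beta$, $0<\beta\le1$, denotes $\beta$-Hölder continuous functions (Lipschitz if $\beta=1$). *)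

theory Defs
  imports "HOL-Analysis.Analysis" "HOL-Algebra.Group" "HOL-Analysis.Finite_Function_Topology"
begin

section \<open>Labelled trees and forests\<close>

text \<open>
  A value of type \<open>'a rtree\<close> is a nonempty non-planar rooted tree with labels in \<open>'a\<close>.
  A forest is a multiset of nonempty trees; the empty forest is also the empty tree \<open>\<one>\<close>.
  The label set \<open>{1,\<dots>,d}\<close> is rendered by a finite type \<open>'d\<close> with \<open>CARD('d) = d\<close>.
\<close>

datatype 'a rtree = Node 'a "'a rtree multiset"

type_synonym 'a forest = "'a rtree multiset"

primrec tree_size :: "'a rtree \<Rightarrow> nat" where
  "tree_size (Node a f) = Suc (\<Sum>\<^sub># (image_mset tree_size f))"

definition forest_size :: "'a forest \<Rightarrow> nat" where
  "forest_size f = \<Sum>\<^sub># (image_mset tree_size f)"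

primrec vertex_labels :: "'a rtree \<Rightarrow> 'a multiset" where
  "vertex_labels (Node a f) = add_mset a (\<Sum>\<^sub># (image_mset vertex_labels f))"

lemma size_vertex_labels: "size (vertex_labels t) = tree_size t"
proof -
  have "size (sum_mset M) = sum_mset (image_mset size M)" for M :: "'a multiset multiset"
    by (induct M) auto
  then show ?thesis
    by (induct t)
      (auto simp: multiset.map_comp o_def intro!: arg_cong[where f = sum_mset] image_mset_cong)
qed

text \<open>
  A tree shape with enumerated vertices is a tree in which every index of the finite type
  \<open>'v\<close> labels exactly one vertex, so \<open>CARD('v)\<close> is the number of vertices. Labelling vertex
  \<open>i\<close> by \<open>a i\<close> is then \<open>map_rtree a\<close>.
\<close>

definition enumerated_shape :: "'v rtree \<Rightarrow> bool" where
  "enumerated_shape \<tau> \<longleftrightarrow> (\<forall>v. count (vertex_labels \<tau>) v = 1)"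

section \<open>The Hopf algebra\<close>

text \<open>
  \<open>\<H>\<close> is the monoid algebra of the commutative monoid of forests: addition of multisets is the
  product of forests, and multiplication of \<open>\<H>\<close> is its bilinear extension. Similarly
  \<open>\<H> \<otimes> \<H>\<close> is the monoid algebra of pairs of forests, with \<open>(g, h)\<close> standing for \<open>g \<otimes> h\<close>.
\<close>

type_synonym 'a hopf = "'a forest \<Rightarrow>\<^sub>0 real"

type_synonym 'a hopf2 = "('a forest \<times> 'a forest) \<Rightarrow>\<^sub>0 real"

definition basis_elt :: "'k \<Rightarrow> ('k \<Rightarrow>\<^sub>0 real)" where
  "basis_elt k = Poly_Mapping.single k 1"

definition lin_ext :: "('k \<Rightarrow> 'b::real_vector) \<Rightarrow> ('k \<Rightarrow>\<^sub>0 real) \<Rightarrow> 'b" where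
  "lin_ext \<phi> p = (\<Sum>k\<in>Poly_Mapping.keys p. Poly_Mapping.lookup p k *\<^sub>R \<phi> k)"

definition id_tensor_graft :: "'a \<Rightarrow> 'a hopf2 \<Rightarrow> 'a hopf2" where
  "id_tensor_graft a = lin_ext (\<lambda>(g, h). basis_elt (g, {#Node a h#}))"

primrec coproduct_tree :: "'a rtree \<Rightarrow> 'a hopf2" where
  "coproduct_tree (Node a f) =
     basis_elt ({#Node a f#}, {#}) + id_tensor_graft a (prod_mset (image_mset coproduct_tree f))"

definition coproduct :: "'a hopf \<Rightarrow> 'a hopf2" where
  "coproduct = lin_ext (\<lambda>f. prod_mset (image_mset coproduct_tree f))"

lemma lookup_scaleR [simp]:
  "Poly_Mapping.lookup (c *\<^sub>R p) k = c *\<^sub>R Poly_Mapping.lookup p k"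
proof -
  have "finite {k. c *\<^sub>R Poly_Mapping.lookup p k \<noteq> 0}"
    by (rule finite_subset[OF _ finite_lookup[of p]]) auto
  then show ?thesis by (simp add: scaleR_poly_mapping_def Abs_poly_mapping_inverse)
qed

lemma linear_lin_ext: "linear (lin_ext \<phi>)"
proof (rule linearI)
  have *: "lin_ext \<phi> p = (\<Sum>k\<in>A. Poly_Mapping.lookup p k *\<^sub>R \<phi> k)"
    if "finite A" "Poly_Mapping.keys p \<subseteq> A" for A and p :: "'a \<Rightarrow>\<^sub>0 real"
    unfolding lin_ext_def using that by (intro sum.mono_neutral_left) (auto simp: in_keys_iff)
  fix p q :: "'a \<Rightarrow>\<^sub>0 real"
  have "finite (Poly_Mapping.keys p \<union> Poly_Mapping.keys q)" by simp
  with keys_add[of p q] show "lin_ext \<phi> (p + q) = lin_ext \<phi> p + lin_ext \<phi> q"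
    by (simp add: *[of "Poly_Mapping.keys p \<union> Poly_Mapping.keys q"] lookup_add scaleR_add_left sum.distrib)
next
  fix r :: real and p :: "'a \<Rightarrow>\<^sub>0 real"
  show "lin_ext \<phi> (r *\<^sub>R p) = r *\<^sub>R lin_ext \<phi> p"
  proof (cases "r = 0")
    case True then show ?thesis by (simp add: lin_ext_def)
  next
    case False
    then have "Poly_Mapping.keys (r *\<^sub>R p) = Poly_Mapping.keys p" by (auto simp: in_keys_iff)
    then show ?thesis by (simp add: lin_ext_def scaleR_sum_right)
  qed
qed

lemma lin_ext_basis [simp]: "lin_ext \<phi> (basis_elt k) = \<phi> k"
  by (simp add: lin_ext_def basis_elt_def)

lemma hopf_induct:
  fixes p :: "'k \<Rightarrow>\<^sub>0 real"
  assumes "\<And>k. P (basis_elt k)" "\<And>p q. P p \<Longrightarrow> P q \<Longrightarrow> P (p+q)" "\<And>c p. P p \<Longrightarrow> P (c *\<^sub>R p)"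
  shows "P p"
proof -
  have e: "c *\<^sub>R basis_elt k = Poly_Mapping.single k c" for c :: real and k::'k
    by (rule poly_mapping_eqI) (simp add: basis_elt_def lookup_single when_def)
  have s: "P (Poly_Mapping.single k c)" for c k using assms(1,3) e by metis
  have "P (\<Sum>k\<in>A. Poly_Mapping.single k (Poly_Mapping.lookup p k))" if "finite A" for A
    using that
  proof (induct A rule: finite_induct)
    case empty then show ?case using s[of undefined 0] by simp
  next
    case (insert k A) then show ?case by (simp add: assms(2) s)
  qed
  moreover have "(\<Sum>k\<in>Poly_Mapping.keys p. Poly_Mapping.single k (Poly_Mapping.lookup p k)) = p"
    by (rule poly_mapping_eqI) (auto simp: lookup_sum lookup_single when_def in_keys_iff)
  ultimately show ?thesis by (metis finite_keys)
qed

lemma basis_elt_add: "basis_elt (f+g) = basis_elt f * basis_elt g"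
  by (simp add: basis_elt_def mult_single)

lemma scaleR_mult_left: "(c *\<^sub>R p) * q = c *\<^sub>R (p * q)"  for p q :: "'k::comm_monoid_add \<Rightarrow>\<^sub>0 real"
proof -
  have "c *\<^sub>R p = Poly_Mapping.single 0 c * p" for p :: "'k::comm_monoid_add \<Rightarrow>\<^sub>0 real"
    apply (subst mult_map_scale_conv_mult[symmetric])
    by (rule poly_mapping_eqI) (simp add: map.rep_eq when_def)
  then show ?thesis by (simp add: mult.assoc)
qed

text \<open>The equations characterising the coproduct as an algebra morphism.\<close>

lemma coproduct_linear: "linear coproduct"
  by (simp add: coproduct_def linear_lin_ext)

lemma coproduct_basis: "coproduct (basis_elt f) = prod_mset (image_mset coproduct_tree f)"
  by (simp add: coproduct_def)

lemma coproduct_one: "coproduct 1 = 1"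
  using coproduct_basis[of "{#}"] by (simp add: basis_elt_def flip: zero_multiset_def)

lemma coproduct_mult: "coproduct (p * q) = coproduct p * coproduct q"
proof (induct p rule: hopf_induct)
  case (1 k)
  show ?case
  proof (induct q rule: hopf_induct)
    case (1 l) show ?case by (simp add: coproduct_basis flip: basis_elt_add)
  next
    case (2 p q) then show ?case by (simp add: linear_add[OF coproduct_linear] distrib_left)
  next
    case (3 c q) then show ?case
      by (metis scaleR_mult_left mult.commute linear_scale[OF coproduct_linear])
  qed
next
  case (2 p q) then show ?case by (simp add: linear_add[OF coproduct_linear] distrib_right)
next
  case (3 c q) then show ?case by (simp add: linear_scale[OF coproduct_linear] scaleR_mult_left)
qed

lemma coproduct_graft: "coproduct (basis_elt {#Node a f#}) =
   basis_elt ({#Node a f#}, {#}) + id_tensor_graft a (coproduct (basis_elt f))"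
  by (simp add: coproduct_basis)

section \<open>Characters and the truncated group\<close>

type_synonym 'a functional = "'a hopf \<Rightarrow> real"

definition tensor_functional :: "'a functional \<Rightarrow> 'a functional \<Rightarrow> 'a hopf2 \<Rightarrow> real" where
  "tensor_functional x y = lin_ext (\<lambda>(g, h). x (basis_elt g) * y (basis_elt h))"

definition star :: "'a functional \<Rightarrow> 'a functional \<Rightarrow> 'a functional" where
  "star x y h = tensor_functional x y (coproduct h)"

definition counit :: "'a functional" where
  "counit p = Poly_Mapping.lookup p {#}"

definition characters :: "'a functional set" where
  "characters = {x. linear x \<and> x 1 = 1 \<and> (\<forall>p q. x (p * q) = x p * x q)}"

definition agree_rel :: "nat \<Rightarrow> ('a functional \<times> 'a functional) set" where
  "agree_rel N = {(x, y). x \<in> characters \<and> y \<in> characters \<and>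
     (\<forall>f. forest_size f \<le> N \<longrightarrow> x (basis_elt f) = y (basis_elt f))}"

definition trunc_group :: "nat \<Rightarrow> 'a functional set monoid" where
  "trunc_group N =
     \<lparr>carrier = characters // agree_rel N,
      mult = (\<lambda>A B. \<Union>x\<in>A. \<Union>y\<in>B. agree_rel N `` {star x y}),
      one = agree_rel N `` {counit}\<rparr>"

text \<open>
  Evaluation of an element of the truncated group at a forest. All representatives of an element
  of \<open>trunc_group N\<close> give the same value only at forests of size at most \<open>N\<close>; elsewhere the
  value is unspecified.
\<close>

definition pairing :: "'a functional set \<Rightarrow> 'a forest \<Rightarrow> real" where
  "pairing A f = the_elem ((\<lambda>x. x (basis_elt f)) ` A)"

section \<open>Branched rough paths\<close>

definition increment :: "nat \<Rightarrow> (real \<Rightarrow> 'a functional set) \<Rightarrow> real \<Rightarrow> real \<Rightarrow> 'a functional set" where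
  "increment N X s t = inv\<^bsub>trunc_group N\<^esub> (X s) \<otimes>\<^bsub>trunc_group N\<^esub> X t"

definition branched_rough_path :: "real \<Rightarrow> nat \<Rightarrow> real \<Rightarrow> (real \<Rightarrow> 'd functional set) \<Rightarrow> bool" where
  "branched_rough_path \<gamma> N T X \<longleftrightarrow>
     X \<in> {0..T} \<rightarrow> carrier (trunc_group N) \<and>
     (\<forall>f. forest_size f \<le> N \<longrightarrow>
        bdd_above {\<bar>pairing (increment N X s t) f\<bar> / \<bar>t - s\<bar> powr (\<gamma> * forest_size f) | s t.
                     0 \<le> s \<and> s < t \<and> t \<le> T})"

text \<open>
  The tensor space \<open>(\<real>\<^sup>d)\<^sup>\<otimes>\<^sup>n\<close>, with the \<open>n\<close> factors indexed by \<open>'v\<close>, is rendered in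
  coordinates as \<open>real ^ ('v \<Rightarrow> 'd)\<close>; the multi-index \<open>(a\<^sub>1, \<dots>, a\<^sub>n)\<close> is a function \<open>'v \<Rightarrow> 'd\<close>.
\<close>

definition tensor_pairing ::
    "'d functional set \<Rightarrow> 'v rtree \<Rightarrow> real ^ ('v::finite \<Rightarrow> 'd::finite)" where
  "tensor_pairing A \<tau> = (\<chi> a. pairing A {#map_rtree a \<tau>#})"

definition holder_on :: "real \<Rightarrow> real set \<Rightarrow> (real \<Rightarrow> 'b::metric_space) \<Rightarrow> bool" where
  "holder_on \<beta> S f \<longleftrightarrow> (\<exists>C. \<forall>s\<in>S. \<forall>t\<in>S. dist (f s) (f t) \<le> C * \<bar>t - s\<bar> powr \<beta>)"

end

theory Submission
  imports Defs
begin

text \<open>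
  Write \<open>n\<close> for the number of vertices of \<open>\<tau>\<close>, \<open>m = n div 2\<close>, and \<open>x\<close>, \<open>z\<close> for characters
  representing \<open>X s\<close> and the increment from \<open>s\<close> to \<open>t\<close>. Since \<open>\<Delta>\<close> preserves the number of
  vertices, \<open>x \<star> z\<close> evaluated at a tree \<open>\<sigma>\<close> is \<open>x \<sigma> + z \<sigma>\<close> plus a combination of products
  \<open>x g * z h\<close> in which \<open>g\<close> and \<open>h\<close> are nonempty forests with as many vertices together as \<open>\<sigma>\<close>.
  A character that vanishes on the trees with at most \<open>m\<close> vertices vanishes on the nonempty forests
  with at most \<open>m\<close> vertices, because each of their factors is such a tree. For \<open>\<sigma>\<close> with at most
  \<open>m\<close> vertices the mixed products therefore disappear on account of \<open>x\<close> alone, and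
  \<open>x \<star> z = X t\<close> shows that \<open>z\<close> vanishes on small trees as well. For \<open>\<sigma> = \<tau>\<close> one of \<open>g\<close> and \<open>h\<close>
  has at most \<open>m\<close> vertices, since \<open>n \<le> 2 * m + 1\<close>, so the mixed products disappear again. Hence
  the increment at \<open>\<tau>\<close> is the difference of the values of \<open>X t\<close> and \<open>X s\<close> at \<open>\<tau>\<close>
  (\<open>increment_on_tree\<close>). The function required is the evaluation of \<open>X\<close> at \<open>\<tau>\<close>, and its
  regularity is the bound on increments in the definition of a branched rough path.

  The equation \<open>x \<star> z = X t\<close> needs the increment to be formed with a genuine inverse, so that
  the truncated characters have to be shown to be a group (\<open>group_trunc_group\<close>). For this the
  convolution by \<open>x\<close> on the left is written as composition with the endomorphism
  \<open>translate x = (x \<otimes> id) \<circ> \<Delta>\<close>, which satisfies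
  \<open>translate x [f]\<^sub>a = x [f]\<^sub>a 1 + [translate x f]\<^sub>a\<close>. This recursion gives associativity without
  the threefold tensor product (\<open>translate_star\<close>) and gives left inverses by recursion over the
  branches of a tree (\<open>star_inverse_character\<close>).
\<close>

section \<open>Algebra morphisms on the Hopf algebra\<close>

text \<open>
  The target is left general in order to treat characters and endomorphisms of \<open>\<H>\<close> alike.
\<close>

definition alg_hom :: "('a hopf \<Rightarrow> 'b::{real_vector, comm_monoid_mult}) \<Rightarrow> bool" where
  "alg_hom F \<longleftrightarrow> linear F \<and> F 1 = 1 \<and> (\<forall>p q. F (p * q) = F p * F q)"

lemma characters_alg_hom: "x \<in> characters \<longleftrightarrow> alg_hom x"
  by (simp add: characters_def alg_hom_def)

lemma linear_eqI_basis:
  assumes "linear F" "linear G" "\<And>k. F (basis_elt k) = G (basis_elt k)"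
  shows "F p = G p"
  by (induct p rule: hopf_induct)
    (simp_all add: assms linear_add linear_scale)

lemma basis_elt_empty: "basis_elt ({#} :: 'a forest) = 1"
  by (simp add: basis_elt_def flip: zero_multiset_def)

lemma basis_elt_add_mset: "basis_elt (add_mset t f) = basis_elt {#t#} * basis_elt f"
  by (simp flip: basis_elt_add)

lemma alg_hom_basis:
  assumes "alg_hom F"
  shows "F (basis_elt f) = prod_mset (image_mset (\<lambda>t. F (basis_elt {#t#})) f)"
proof (induct f)
  case empty
  show ?case using assms by (simp add: basis_elt_empty alg_hom_def)
next
  case (add t f)
  then show ?case using assms by (simp add: basis_elt_add_mset[of t f] alg_hom_def)
qed

lemma alg_hom_eq_forest:
  assumes "alg_hom F" "alg_hom G" "\<And>t. t \<in># f \<Longrightarrow> F (basis_elt {#t#}) = G (basis_elt {#t#})"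
  shows "F (basis_elt f) = G (basis_elt f)"
  using assms(3)
  by (simp add: alg_hom_basis[OF assms(1), of f] alg_hom_basis[OF assms(2), of f] cong: image_mset_cong)

lemma alg_hom_eqI:
  assumes "alg_hom F" "alg_hom G" "\<And>t. F (basis_elt {#t#}) = G (basis_elt {#t#})"
  shows "F = G"
proof
  fix p
  show "F p = G p"
  proof (rule linear_eqI_basis)
    show "linear F" "linear G" using assms by (auto simp: alg_hom_def)
    show "F (basis_elt f) = G (basis_elt f)" for f
      using assms by (rule alg_hom_eq_forest)
  qed
qed

text \<open>
  Structural induction on trees: by multiplicativity, agreement on the branches of a tree is
  agreement on the forest that they form.
\<close>

lemma alg_hom_eqI_graft:
  assumes F: "alg_hom F" and G: "alg_hom G"
    and step: "\<And>a f. F (basis_elt f) = G (basis_elt f) \<Longrightarrow>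
        F (basis_elt {#Node a f#}) = G (basis_elt {#Node a f#})"
  shows "F = G"
proof (rule alg_hom_eqI[OF F G])
  fix t show "F (basis_elt {#t#}) = G (basis_elt {#t#})"
    by (induct t) (blast intro: step alg_hom_eq_forest[OF F G])
qed

lemma alg_hom_compose:
  assumes "alg_hom F" "alg_hom G"
  shows "alg_hom (\<lambda>p. G (F p))"
  using assms linear_compose[of F G] by (auto simp: alg_hom_def o_def)

text \<open>
  Both sides are bilinear in \<open>p\<close> and \<open>q\<close>. The compatibility of scaling and product in the target
  enters as a hypothesis so that the lemma applies to real numbers and to formal sums.
\<close>

lemma linear_multiplicativeI_basis:
  fixes F :: "('k::comm_monoid_add \<Rightarrow>\<^sub>0 real) \<Rightarrow> 'b::{real_vector, comm_ring_1}"
  assumes scale: "\<And>c (u :: 'b) v. (c *\<^sub>R u) * v = c *\<^sub>R (u * v)"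
    and F: "linear F"
    and basis: "\<And>k l. F (basis_elt (k + l)) = F (basis_elt k) * F (basis_elt l)"
  shows "F (p * q) = F p * F q"
proof (induct p rule: hopf_induct)
  case (1 k)
  show ?case
  proof (induct q rule: hopf_induct)
    case (1 l) show ?case by (simp add: basis flip: basis_elt_add)
  next
    case (2 p q) then show ?case by (simp add: linear_add[OF F] distrib_left)
  next
    case (3 c q) then show ?case
      by (metis Defs.scaleR_mult_left scale mult.commute linear_scale[OF F])
  qed
next
  case (2 p q) then show ?case by (simp add: linear_add[OF F] distrib_right)
next
  case (3 c q) then show ?case by (simp add: linear_scale[OF F] scale Defs.scaleR_mult_left)
qed

definition multiplicative_extension :: "('a rtree \<Rightarrow> real) \<Rightarrow> 'a functional" where
  "multiplicative_extension v = lin_ext (\<lambda>f. prod_mset (image_mset v f))"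

lemma multiplicative_extension_tree [simp]:
  "multiplicative_extension v (basis_elt {#t#}) = v t"
  by (simp add: multiplicative_extension_def)

lemma multiplicative_extension_character: "multiplicative_extension v \<in> characters"
proof -
  let ?F = "multiplicative_extension v"
  have F: "linear ?F" by (simp add: multiplicative_extension_def linear_lin_ext)
  have b: "?F (basis_elt (k + l)) = ?F (basis_elt k) * ?F (basis_elt l)" for k l
    by (simp add: multiplicative_extension_def)
  have "?F (p * q) = ?F p * ?F q" for p q
    by (rule linear_multiplicativeI_basis[OF _ F b]) simp
  moreover have "?F 1 = 1"
    by (simp add: multiplicative_extension_def flip: basis_elt_empty)
  ultimately show ?thesis using F by (simp add: characters_def)
qed

section \<open>Translation by a character\<close>

definition graft :: "'a \<Rightarrow> 'a hopf \<Rightarrow> 'a hopf" where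
  "graft a = lin_ext (\<lambda>f. basis_elt {#Node a f#})"

definition contract_left :: "'a functional \<Rightarrow> 'a hopf2 \<Rightarrow> 'a hopf" where
  "contract_left x = lin_ext (\<lambda>(g, h). x (basis_elt g) *\<^sub>R basis_elt h)"

definition translate :: "'a functional \<Rightarrow> 'a hopf \<Rightarrow> 'a hopf" where
  "translate x p = contract_left x (coproduct p)"

lemma linear_graft: "linear (graft a)"
  by (simp add: graft_def linear_lin_ext)

lemma linear_contract_left: "linear (contract_left x)"
  by (simp add: contract_left_def linear_lin_ext)

lemma linear_translate: "linear (translate x)"
  using linear_compose[OF coproduct_linear linear_contract_left]
  by (simp add: translate_def[abs_def] o_def)

lemma star_eq_translate:
  assumes "linear y"
  shows "star x y p = y (translate x p)"
proof -
  have "tensor_functional x y q = y (contract_left x q)" for q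
  proof (rule linear_eqI_basis[where F = "tensor_functional x y" and G = "\<lambda>q. y (contract_left x q)"])
    show "linear (tensor_functional x y)" by (simp add: tensor_functional_def linear_lin_ext)
    show "linear (\<lambda>q. y (contract_left x q))"
      using linear_compose[OF linear_contract_left assms] by (simp add: o_def)
  qed (auto simp: tensor_functional_def contract_left_def linear_scale[OF assms])
  then show ?thesis by (simp add: star_def translate_def)
qed

lemma contract_left_mult:
  assumes "x \<in> characters"
  shows "contract_left x (p * q) = contract_left x p * contract_left x q"
proof (rule linear_multiplicativeI_basis[OF Defs.scaleR_mult_left linear_contract_left])
  fix k l :: "'a forest \<times> 'a forest"
  have scale_right: "p * (c *\<^sub>R q) = c *\<^sub>R (p * q)" for c and p q :: "'a hopf"
    by (metis Defs.scaleR_mult_left mult.commute)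
  show "contract_left x (basis_elt (k + l)) = contract_left x (basis_elt k) * contract_left x (basis_elt l)"
    using assms scale_right
    by (cases k; cases l)
      (simp add: contract_left_def characters_def basis_elt_add Defs.scaleR_mult_left mult.commute)
qed

lemma contract_left_id_tensor_graft:
  "contract_left x (id_tensor_graft a p) = graft a (contract_left x p)"
proof (rule linear_eqI_basis[where F = "\<lambda>p. contract_left x (id_tensor_graft a p)"
      and G = "\<lambda>p. graft a (contract_left x p)"])
  have 1: "linear (id_tensor_graft a)" by (simp add: id_tensor_graft_def linear_lin_ext)
  show "linear (\<lambda>p. contract_left x (id_tensor_graft a p))"
    using linear_compose[OF 1 linear_contract_left] by (simp add: o_def)
  show "linear (\<lambda>p. graft a (contract_left x p))"
    using linear_compose[OF linear_contract_left linear_graft] by (simp add: o_def)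
  fix k :: "'a forest \<times> 'a forest"
  show "contract_left x (id_tensor_graft a (basis_elt k)) = graft a (contract_left x (basis_elt k))"
    by (cases k) (simp add: contract_left_def id_tensor_graft_def linear_scale[OF linear_graft],
       simp add: graft_def)
qed

lemma basis_elt_empty_pair: "basis_elt ({#} :: 'a forest, {#} :: 'a forest) = 1"
  by (simp add: basis_elt_def flip: zero_multiset_def zero_prod_def)

text \<open>
  Grafting acts on the right factor of \<open>\<Delta>\<close> only, and the left factor is the one that \<open>x\<close>
  consumes. Hence translation commutes with grafting up to a constant.
\<close>

lemma translate_graft:
  "translate x (basis_elt {#Node a f#}) =
     x (basis_elt {#Node a f#}) *\<^sub>R 1 + graft a (translate x (basis_elt f))"
  by (simp add: translate_def coproduct_graft linear_add[OF linear_contract_left]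
      contract_left_id_tensor_graft)
    (simp add: contract_left_def basis_elt_empty)

lemma alg_hom_translate:
  assumes "x \<in> characters"
  shows "alg_hom (translate x)"
proof -
  have "translate x 1 = contract_left x (basis_elt ({#}, {#}))"
    by (simp add: translate_def coproduct_one basis_elt_empty_pair)
  also have "\<dots> = 1"
    using assms by (simp add: contract_left_def basis_elt_empty characters_def)
  finally show ?thesis
    using contract_left_mult[OF assms]
    by (simp add: alg_hom_def linear_translate) (simp add: translate_def coproduct_mult)
qed

lemma star_character:
  assumes "x \<in> characters" "y \<in> characters"
  shows "star x y \<in> characters"
proof -
  have "linear y" using assms by (simp add: characters_def)
  then have "star x y = (\<lambda>p. y (translate x p))" by (simp add: star_eq_translate fun_eq_iff)
  then show ?thesis
    using alg_hom_compose[OF alg_hom_translate[OF assms(1)]] assms(2) by (simp add: characters_alg_hom)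
qed

text \<open>
  This is coassociativity, tested against two characters. Both sides are algebra morphisms, so it
  is enough to pass from a forest \<open>f\<close> to the tree \<open>[f]\<^sub>a\<close>, where \<open>translate_graft\<close> turns the two
  sides into \<open>(x \<star> y) [f]\<^sub>a 1 + [translate (x \<star> y) f]\<^sub>a\<close> and
  \<open>x [f]\<^sub>a 1 + y [translate x f]\<^sub>a 1 + [translate y (translate x f)]\<^sub>a\<close>. The constants are equal
  because \<open>x \<star> y = y \<circ> translate x\<close>.
\<close>

lemma translate_star:
  assumes x: "x \<in> characters" and y: "y \<in> characters"
  shows "translate (star x y) = (\<lambda>p. translate y (translate x p))"
proof (rule alg_hom_eqI_graft)
  show "alg_hom (translate (star x y))"
    by (intro alg_hom_translate star_character x y)
  show "alg_hom (\<lambda>p. translate y (translate x p))"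
    by (rule alg_hom_compose[OF alg_hom_translate[OF x] alg_hom_translate[OF y]])
  have lin: "linear y" using y by (simp add: characters_def)
  have one: "translate y 1 = 1" "y 1 = 1"
    using alg_hom_translate[OF y] y by (auto simp: alg_hom_def characters_def)
  have graft: "translate y (graft a p) = y (graft a p) *\<^sub>R 1 + graft a (translate y p)" for a p
  proof (rule linear_eqI_basis[where F = "\<lambda>p. translate y (graft a p)"
        and G = "\<lambda>p. y (graft a p) *\<^sub>R 1 + graft a (translate y p)"])
    show "linear (\<lambda>p. translate y (graft a p))"
      using linear_compose[OF linear_graft linear_translate] by (simp add: o_def)
    show "linear (\<lambda>p. y (graft a p) *\<^sub>R 1 + graft a (translate y p))"
      by (intro linearI) (simp_all add: linear_add[OF linear_graft] linear_scale[OF linear_graft] linear_add[OF lin]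
          linear_scale[OF lin] linear_add[OF linear_translate] linear_scale[OF linear_translate]
          scaleR_add_left scaleR_add_right)
    show "translate y (graft a (basis_elt k)) =
        y (graft a (basis_elt k)) *\<^sub>R 1 + graft a (translate y (basis_elt k))" for k
      using translate_graft[of y a k] by (simp add: graft_def)
  qed
  fix a f
  assume IH: "translate (star x y) (basis_elt f) = translate y (translate x (basis_elt f))"
  show "translate (star x y) (basis_elt {#Node a f#}) =
      translate y (translate x (basis_elt {#Node a f#}))"
    by (simp add: translate_graft IH graft star_eq_translate[OF lin] one scaleR_add_left
        linear_add[OF lin] linear_scale[OF lin] linear_add[OF linear_translate]
        linear_scale[OF linear_translate])
qed

section \<open>The group of truncated characters\<close>

lemma star_assoc:
  assumes "x \<in> characters" "y \<in> characters" "z \<in> characters"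
  shows "star (star x y) z = star x (star y z)"
proof
  fix p
  have "linear z" "linear (star y z)"
    using assms star_character by (auto simp: characters_def)
  then show "star (star x y) z p = star x (star y z) p"
    by (simp add: star_eq_translate translate_star assms)
qed

lemma counit_basis: "counit (basis_elt f) = (if f = {#} then 1 else 0)"
  by (simp add: counit_def basis_elt_def lookup_single)

lemma counit_character: "(counit :: 'a functional) \<in> characters"
proof -
  have "(counit :: 'a functional) = multiplicative_extension (\<lambda>_. 0)"
  proof (rule ext, rule linear_eqI_basis[where F = counit])
    show "linear (counit :: 'a functional)"
      by (rule linearI) (simp_all add: counit_def lookup_add)
    show "linear (multiplicative_extension (\<lambda>_. 0) :: 'a functional)"
      by (simp add: multiplicative_extension_def linear_lin_ext)
    show "counit (basis_elt k) = multiplicative_extension (\<lambda>_. 0) (basis_elt k)" for k :: "'a forest"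
      by (cases k) (simp_all add: counit_basis multiplicative_extension_def)
  qed
  then show ?thesis
    using multiplicative_extension_character[of "\<lambda>_ :: 'a rtree. 0"] by simp
qed

lemma translate_counit: "translate counit p = p"
proof -
  have "translate counit = (\<lambda>p :: 'a hopf. p)"
  proof (rule alg_hom_eqI_graft)
    show "alg_hom (translate counit)" by (intro alg_hom_translate counit_character)
    show "alg_hom (\<lambda>p :: 'a hopf. p)" by (simp add: alg_hom_def linear_iff)
    show "translate counit (basis_elt {#Node a f#}) = basis_elt {#Node a f#}"
      if "translate counit (basis_elt f) = basis_elt f" for a and f :: "'a forest"
      by (simp add: translate_graft that counit_basis) (simp add: graft_def)
  qed
  then show ?thesis by metis
qed

lemma counit_graft: "counit (graft a (p :: 'a hopf)) = 0"
proof -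
  have l: "linear (counit :: 'a functional)" using counit_character[where 'a = 'a] by (simp add: characters_def)
  show ?thesis
    by (induct p rule: hopf_induct)
      (simp_all add: linear_add[OF linear_graft] linear_scale[OF linear_graft] linear_add[OF l]
        linear_scale[OF l], simp add: graft_def counit_basis)
qed

lemma star_counit_right:
  fixes x :: "'a functional"
  assumes "x \<in> characters"
  shows "star x counit = x"
proof (rule alg_hom_eqI)
  show "alg_hom (star x counit)" "alg_hom x"
    using assms star_character[OF assms counit_character] by (auto simp: characters_alg_hom)
  have l: "linear (counit :: 'a functional)" and one: "counit (1 :: 'a hopf) = 1"
    using counit_character[where 'a = 'a] by (auto simp: characters_def)
  show "star x counit (basis_elt {#t#}) = x (basis_elt {#t#})" for t
    by (cases t)
      (simp add: star_eq_translate[OF l] translate_graft linear_add[OF l] linear_scale[OF l] one counit_graft)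
qed

lemma star_counit_left:
  assumes "x \<in> characters"
  shows "star counit x = x"
proof
  fix p show "star counit x p = x p"
    using assms by (simp add: star_eq_translate characters_def translate_counit)
qed

text \<open>
  A left inverse \<open>y\<close> of \<open>x\<close> must satisfy \<open>0 = x (translate y [f]\<^sub>a) = y [f]\<^sub>a + x [translate y f]\<^sub>a\<close>,
  which determines \<open>y\<close> at a tree from \<open>translate y\<close> at its branches. The function below is
  \<open>translate y\<close> on trees; solving for \<open>translate y\<close> and not for \<open>y\<close> keeps the recursion
  primitive.
\<close>

primrec inverse_translate :: "'a functional \<Rightarrow> 'a rtree \<Rightarrow> 'a hopf" where
  "inverse_translate x (Node a f) =
     graft a (prod_mset (image_mset (inverse_translate x) f))
     - x (graft a (prod_mset (image_mset (inverse_translate x) f))) *\<^sub>R 1"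

definition inverse_character :: "'a functional \<Rightarrow> 'a functional" where
  "inverse_character x = multiplicative_extension
     (\<lambda>t. case t of Node a f \<Rightarrow> - x (graft a (prod_mset (image_mset (inverse_translate x) f))))"

lemma inverse_character: "inverse_character x \<in> characters"
  by (simp add: inverse_character_def multiplicative_extension_character)

lemma translate_inverse_character:
  "translate (inverse_character x) (basis_elt f) = prod_mset (image_mset (inverse_translate x) f)"
proof -
  note hom = alg_hom_translate[OF inverse_character, of x]
  have "translate (inverse_character x) (basis_elt {#t#}) = inverse_translate x t" for t
  proof (induct t)
    case (Node a f)
    then have "translate (inverse_character x) (basis_elt f) = prod_mset (image_mset (inverse_translate x) f)"
      by (simp add: alg_hom_basis[OF hom, of f] cong: image_mset_cong)
    then show ?case by (simp add: translate_graft) (simp add: inverse_character_def)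
  qed
  then show ?thesis by (simp add: alg_hom_basis[OF hom, of f])
qed

lemma star_inverse_character:
  assumes "x \<in> characters"
  shows "star (inverse_character x) x = counit"
proof (rule alg_hom_eqI)
  show "alg_hom (star (inverse_character x) x)" "alg_hom (counit :: 'a functional)"
    using star_character[OF inverse_character assms] counit_character by (auto simp: characters_alg_hom)
  have l: "linear x" and one: "x 1 = 1" using assms by (auto simp: characters_def)
  show "star (inverse_character x) x (basis_elt {#t#}) = counit (basis_elt {#t#})" for t
  proof (cases t)
    case (Node a f)
    then show ?thesis
      by (simp add: star_eq_translate[OF l] translate_graft linear_add[OF l] linear_scale[OF l] one
          translate_inverse_character counit_basis) (simp add: inverse_character_def)
  qed
qed

lemma forest_size_add [simp]: "forest_size (f + g) = forest_size f + forest_size g"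
  by (simp add: forest_size_def)

lemma forest_size_empty [simp]: "forest_size {#} = 0"
  by (simp add: forest_size_def)

lemma forest_size_add_mset [simp]: "forest_size (add_mset t f) = tree_size t + forest_size f"
  by (simp add: forest_size_def)

lemma tree_size_pos: "tree_size t > 0"
  by (cases t) simp

text \<open>
  The coproduct is graded by the number of vertices: grafting moves the new root to the right
  factor along with its branches, and the product of formal sums adds sizes.
\<close>

lemma keys_coproduct_basis:
  assumes "(g, h) \<in> Poly_Mapping.keys (coproduct (basis_elt f))"
  shows "forest_size g + forest_size h = forest_size f"
proof -
  have forest: "Poly_Mapping.keys (prod_mset (image_mset coproduct_tree f))
        \<subseteq> {(g, h). forest_size g + forest_size h = forest_size f}"
    if "\<And>t. t \<in># f \<Longrightarrow> Poly_Mapping.keys (coproduct_tree t)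
        \<subseteq> {(g, h). forest_size g + forest_size h = tree_size t}" for f :: "'a forest"
    using that
  proof (induct f)
    case empty
    then show ?case by (auto simp: basis_elt_def simp flip: basis_elt_empty_pair)
  next
    case (add t f)
    let ?P = "prod_mset (image_mset coproduct_tree f)"
    have "Poly_Mapping.keys ?P \<subseteq> {(g, h). forest_size g + forest_size h = forest_size f}"
      using add by simp
    moreover have "Poly_Mapping.keys (coproduct_tree t)
        \<subseteq> {(g, h). forest_size g + forest_size h = tree_size t}"
      using add by simp
    ultimately show ?case
      using keys_mult[of "coproduct_tree t" ?P] by fastforce
  qed
  have tree: "Poly_Mapping.keys (coproduct_tree t)
        \<subseteq> {(g, h). forest_size g + forest_size h = tree_size t}" for t :: "'a rtree"
  proof (induct t)
    case (Node a f)
    let ?P = "prod_mset (image_mset coproduct_tree f)"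
    have P: "Poly_Mapping.keys ?P \<subseteq> {(g, h). forest_size g + forest_size h = forest_size f}"
      using Node by (rule forest)
    have "Poly_Mapping.keys (id_tensor_graft a ?P) \<subseteq>
        (\<Union>k\<in>Poly_Mapping.keys ?P. {(fst k, {#Node a (snd k)#})})"
    proof
      fix k assume k: "k \<in> Poly_Mapping.keys (id_tensor_graft a ?P)"
      show "k \<in> (\<Union>k\<in>Poly_Mapping.keys ?P. {(fst k, {#Node a (snd k)#})})"
      proof (rule ccontr)
        assume "\<not> ?thesis"
        then have "Poly_Mapping.lookup (id_tensor_graft a ?P) k = 0"
          by (auto simp: id_tensor_graft_def lin_ext_def lookup_sum case_prod_beta basis_elt_def
              lookup_single when_def intro!: sum.neutral)
        then show False using k by (simp add: in_keys_iff)
      qed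
    qed
    then have "Poly_Mapping.keys (id_tensor_graft a ?P)
        \<subseteq> {(g, h). forest_size g + forest_size h = tree_size (Node a f)}"
      using P by (fastforce simp: forest_size_def)
    moreover have "Poly_Mapping.keys (basis_elt ({#Node a f#}, {#}))
        \<subseteq> {(g, h). forest_size g + forest_size h = tree_size (Node a f)}"
      by (auto simp: basis_elt_def)
    ultimately show ?case
      using keys_add[of "basis_elt ({#Node a f#}, {#})" "id_tensor_graft a ?P"] by auto
  qed
  show ?thesis
    using forest[OF tree, of f] assms by (auto simp: coproduct_basis)
qed

lemma star_basis:
  "star x y (basis_elt f) = (\<Sum>(g, h)\<in>Poly_Mapping.keys (coproduct (basis_elt f)).
     Poly_Mapping.lookup (coproduct (basis_elt f)) (g, h) * (x (basis_elt g) * y (basis_elt h)))"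
  by (simp add: star_def tensor_functional_def lin_ext_def case_prod_beta)

lemma equiv_agree_rel: "equiv characters (agree_rel N)"
  by (rule equivI) (auto simp: agree_rel_def refl_on_def sym_def trans_def)

text \<open>
  By the grading, \<open>x \<star> y\<close> on forests with at most \<open>N\<close> vertices involves \<open>x\<close> and \<open>y\<close> only on such
  forests, so convolution descends to the truncated characters.
\<close>

lemma star_agree_rel:
  assumes "(x, x') \<in> agree_rel N" "(y, y') \<in> agree_rel N"
  shows "(star x y, star x' y') \<in> agree_rel N"
proof -
  have "star x y (basis_elt f) = star x' y' (basis_elt f)" if "forest_size f \<le> N" for f
    unfolding star_basis
  proof (intro sum.cong refl)
    fix k assume k: "k \<in> Poly_Mapping.keys (coproduct (basis_elt f))"
    obtain g h where gh: "k = (g, h)" by (cases k)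
    have "forest_size g \<le> N" "forest_size h \<le> N"
      using keys_coproduct_basis[of g h f] k gh that by auto
    then have "x (basis_elt g) = x' (basis_elt g)" "y (basis_elt h) = y' (basis_elt h)"
      using assms by (auto simp: agree_rel_def)
    then show "(case k of (g, h) \<Rightarrow> Poly_Mapping.lookup (coproduct (basis_elt f)) (g, h) *
          (x (basis_elt g) * y (basis_elt h))) =
        (case k of (g, h) \<Rightarrow> Poly_Mapping.lookup (coproduct (basis_elt f)) (g, h) *
          (x' (basis_elt g) * y' (basis_elt h)))"
      by (simp add: gh)
  qed
  then show ?thesis
    using assms star_character by (auto simp: agree_rel_def)
qed

lemma trunc_group_mult:
  assumes "x \<in> characters" "y \<in> characters"
  shows "agree_rel N `` {x} \<otimes>\<^bsub>trunc_group N\<^esub> agree_rel N `` {y} = agree_rel N `` {star x y}"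
proof -
  have "congruent2 (agree_rel N) (agree_rel N) (\<lambda>x y. agree_rel N `` {star x y})"
    by (rule congruent2I') (simp add: equiv_class_eq[OF equiv_agree_rel] star_agree_rel)
  from UN_equiv_class2[OF equiv_agree_rel equiv_agree_rel this assms]
  show ?thesis by (simp add: trunc_group_def)
qed

lemma trunc_group_carrierE:
  assumes "A \<in> carrier (trunc_group N)"
  obtains x where "x \<in> characters" "A = agree_rel N `` {x}"
  using assms by (auto simp: trunc_group_def elim!: quotientE)

lemma class_in_carrier: "x \<in> characters \<Longrightarrow> agree_rel N `` {x} \<in> carrier (trunc_group N)"
  by (auto simp: trunc_group_def intro: quotientI)

text \<open>
  The left inverse of a class is that of any representative; since convolution is associative, it
  is also a right inverse.
\<close>

theorem group_trunc_group: "group (trunc_group N :: 'a functional set monoid)"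
proof (rule groupI)
  let ?G = "trunc_group N :: 'a functional set monoid"
  have one: "\<one>\<^bsub>?G\<^esub> = agree_rel N `` {counit}" by (simp add: trunc_group_def)
  show "\<one>\<^bsub>?G\<^esub> \<in> carrier ?G" by (simp add: one class_in_carrier counit_character)
  fix A assume "A \<in> carrier ?G"
  then obtain x where x: "x \<in> characters" "A = agree_rel N `` {x}" by (rule trunc_group_carrierE)
  show "\<one>\<^bsub>?G\<^esub> \<otimes>\<^bsub>?G\<^esub> A = A"
    by (simp add: one x trunc_group_mult counit_character star_counit_left)
  show "\<exists>B\<in>carrier ?G. B \<otimes>\<^bsub>?G\<^esub> A = \<one>\<^bsub>?G\<^esub>"
    by (intro bexI[of _ "agree_rel N `` {inverse_character x}"])
      (simp_all add: one x trunc_group_mult inverse_character star_inverse_character class_in_carrier)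
  fix B assume "B \<in> carrier ?G"
  then obtain y where y: "y \<in> characters" "B = agree_rel N `` {y}" by (rule trunc_group_carrierE)
  show "A \<otimes>\<^bsub>?G\<^esub> B \<in> carrier ?G"
    by (simp add: x y trunc_group_mult class_in_carrier star_character)
  fix C assume "C \<in> carrier ?G"
  then obtain z where z: "z \<in> characters" "C = agree_rel N `` {z}" by (rule trunc_group_carrierE)
  show "A \<otimes>\<^bsub>?G\<^esub> B \<otimes>\<^bsub>?G\<^esub> C = A \<otimes>\<^bsub>?G\<^esub> (B \<otimes>\<^bsub>?G\<^esub> C)"
    by (simp add: x y z trunc_group_mult star_character star_assoc)
qed

lemma pairing_class:
  assumes "x \<in> characters" "forest_size f \<le> N"
  shows "pairing (agree_rel N `` {x}) f = x (basis_elt f)"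
proof -
  have "(\<lambda>x. x (basis_elt f)) ` (agree_rel N `` {x}) = {x (basis_elt f)}"
    using assms equiv_class_self[OF equiv_agree_rel assms(1), of N] by (auto simp: agree_rel_def)
  then show ?thesis by (simp add: pairing_def)
qed

section \<open>Additivity of characters that vanish on small trees\<close>

text \<open>
  Instead of reading off the coefficients of \<open>f \<otimes> 1\<close> and \<open>1 \<otimes> f\<close> in \<open>\<Delta> f\<close>, the sum for
  \<open>x \<star> y\<close> is compared termwise with the sums for \<open>x \<star> \<epsilon> = x\<close> and \<open>\<epsilon> \<star> y = y\<close>, where \<open>\<epsilon>\<close> is the
  counit. The terms agree unless both \<open>g\<close> and \<open>h\<close> are nonempty, in which case \<open>vanish\<close>
  applies, or both are empty, which the grading excludes for nonempty \<open>f\<close>.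
\<close>

lemma star_additive:
  assumes x: "x \<in> characters" and y: "y \<in> characters" and "f \<noteq> {#}"
    and vanish: "\<And>g h. g \<noteq> {#} \<Longrightarrow> h \<noteq> {#} \<Longrightarrow> forest_size g + forest_size h = forest_size f \<Longrightarrow>
      x (basis_elt g) = 0 \<or> y (basis_elt h) = 0"
  shows "star x y (basis_elt f) = x (basis_elt f) + y (basis_elt f)"
proof -
  have one: "x (basis_elt {#}) = 1" "y (basis_elt {#}) = 1"
    using x y by (auto simp: basis_elt_empty characters_def)
  have "forest_size f > 0"
    using \<open>f \<noteq> {#}\<close> tree_size_pos by (cases f) auto
  then have "x (basis_elt g) * y (basis_elt h) =
      x (basis_elt g) * counit (basis_elt h) + counit (basis_elt g) * y (basis_elt h)"
    if "(g, h) \<in> Poly_Mapping.keys (coproduct (basis_elt f))" for g h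
    using keys_coproduct_basis[OF that] vanish[of g h] by (auto simp: counit_basis one)
  then have "star x y (basis_elt f) = star x counit (basis_elt f) + star counit y (basis_elt f)"
    unfolding star_basis sum.distrib[symmetric]
    by (intro sum.cong refl) (auto simp: distrib_left)
  then show ?thesis
    by (simp add: star_counit_left star_counit_right x y)
qed

lemma character_vanishes_on_small_forests:
  assumes "x \<in> characters" and "\<And>t. tree_size t \<le> m \<Longrightarrow> x (basis_elt {#t#}) = 0"
    and "f \<noteq> {#}" "forest_size f \<le> m"
  shows "x (basis_elt f) = 0"
proof -
  obtain t g where f: "f = add_mset t g"
    using \<open>f \<noteq> {#}\<close> by (meson multiset_cases)
  then show ?thesis
    using assms by (simp add: basis_elt_add_mset[of t g] characters_def)
qed

text \<open>
  The hypothesis on the size of \<open>\<tau>\<close> is the largest for which every splitting of its vertices into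
  two parts has a part with at most \<open>m\<close> vertices.
\<close>

lemma increment_on_tree:
  assumes X: "X s \<in> carrier (trunc_group N)" "X t \<in> carrier (trunc_group N)"
    and small: "\<And>r \<sigma>. r \<in> {s, t} \<Longrightarrow> tree_size \<sigma> \<le> m \<Longrightarrow> pairing (X r) {#\<sigma>#} = 0"
    and size: "tree_size \<tau> \<le> N" "tree_size \<tau> \<le> Suc (2 * m)" "m \<le> N"
  shows "pairing (increment N X s t) {#\<tau>#} = pairing (X t) {#\<tau>#} - pairing (X s) {#\<tau>#}"
proof -
  interpret group "trunc_group N :: 'a functional set monoid" by (rule group_trunc_group)
  obtain x where x: "x \<in> characters" "X s = agree_rel N `` {x}" by (rule trunc_group_carrierE[OF X(1)])
  obtain y where y: "y \<in> characters" "X t = agree_rel N `` {y}" by (rule trunc_group_carrierE[OF X(2)])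
  have "increment N X s t \<in> carrier (trunc_group N)"
    using X by (simp add: increment_def)
  then obtain z where z: "z \<in> characters" "increment N X s t = agree_rel N `` {z}"
    by (rule trunc_group_carrierE)
  have "X s \<otimes>\<^bsub>trunc_group N\<^esub> increment N X s t = X t"
    using X by (simp add: increment_def flip: m_assoc)
  then have "agree_rel N `` {star x z} = agree_rel N `` {y}"
    by (simp add: x y z trunc_group_mult)
  then have "(star x z, y) \<in> agree_rel N"
    using y(1) eq_equiv_class[OF _ equiv_agree_rel] by blast
  then have xz: "star x z (basis_elt {#\<sigma>#}) = y (basis_elt {#\<sigma>#})" if "tree_size \<sigma> \<le> N" for \<sigma>
    using that by (auto simp: agree_rel_def)
  have xy: "x (basis_elt {#\<sigma>#}) = 0" "y (basis_elt {#\<sigma>#}) = 0" if "tree_size \<sigma> \<le> m" for \<sigma>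
    using small[of s \<sigma>] small[of t \<sigma>] that size(3) by (simp_all add: x y pairing_class)
  have x0: "x (basis_elt f) = 0" if "f \<noteq> {#}" "forest_size f \<le> m" for f
    using character_vanishes_on_small_forests[OF x(1) xy(1) that] by simp
  \<comment> \<open>Up to size \<open>m\<close>, every mixed term is killed by its left factor, a value of \<open>x\<close>.\<close>
  have "z (basis_elt {#\<sigma>#}) = 0" if \<sigma>: "tree_size \<sigma> \<le> m" for \<sigma>
  proof -
    have "star x z (basis_elt {#\<sigma>#}) = x (basis_elt {#\<sigma>#}) + z (basis_elt {#\<sigma>#})"
      using \<sigma> by (intro star_additive x z) (auto intro: x0)
    then show ?thesis using \<sigma> size(3) by (simp add: xz xy)
  qed
  then have z0: "z (basis_elt f) = 0" if "f \<noteq> {#}" "forest_size f \<le> m" for f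
    using character_vanishes_on_small_forests[OF z(1) _ that] by simp
  have "star x z (basis_elt {#\<tau>#}) = x (basis_elt {#\<tau>#}) + z (basis_elt {#\<tau>#})"
  proof (intro star_additive x z)
    fix g h :: "'a forest"
    assume "g \<noteq> {#}" "h \<noteq> {#}" "forest_size g + forest_size h = forest_size {#\<tau>#}"
    then show "x (basis_elt g) = 0 \<or> z (basis_elt h) = 0"
      using size(2) x0[of g] z0[of h] by (cases "forest_size g \<le> m") auto
  qed simp
  then show ?thesis
    using size(1) by (simp add: x y z pairing_class xz)
qed

section \<open>Regularity of the evaluation at a tree\<close>

lemma tree_size_map_rtree: "tree_size (map_rtree a t) = tree_size t"
  by (induct t) (simp add: multiset.map_comp o_def cong: image_mset_cong)

lemma branched_rough_path_bound:
  assumes X: "branched_rough_path \<gamma> N T X" and f: "forest_size f \<le> N"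
  shows "\<exists>C. \<forall>s t. 0 \<le> s \<and> s < t \<and> t \<le> T \<longrightarrow>
    \<bar>pairing (increment N X s t) f\<bar> \<le> C * \<bar>t - s\<bar> powr (\<gamma> * forest_size f)"
proof -
  have "bdd_above {\<bar>pairing (increment N X s t) f\<bar> / \<bar>t - s\<bar> powr (\<gamma> * forest_size f) | s t.
                     0 \<le> s \<and> s < t \<and> t \<le> T}"
    using X f by (simp add: branched_rough_path_def)
  then obtain C where "\<And>s t. 0 \<le> s \<Longrightarrow> s < t \<Longrightarrow> t \<le> T \<Longrightarrow>
      \<bar>pairing (increment N X s t) f\<bar> / \<bar>t - s\<bar> powr (\<gamma> * forest_size f) \<le> C"
    unfolding bdd_above_def by blast
  then show ?thesis by (intro exI[of _ C]) (simp add: pos_divide_le_eq)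
qed

lemma holder_on_if_increasing_bound:
  assumes "\<And>s t. s \<in> S \<Longrightarrow> t \<in> S \<Longrightarrow> s < t \<Longrightarrow> dist (f s) (f t) \<le> C * \<bar>t - s\<bar> powr \<beta>"
  shows "holder_on \<beta> S f"
  unfolding holder_on_def
proof (intro exI ballI)
  fix s t assume "s \<in> S" "t \<in> S"
  then show "dist (f s) (f t) \<le> C * \<bar>t - s\<bar> powr \<beta>"
    using assms[of s t] assms[of t s]
    by (cases s t rule: linorder_cases) (auto simp: dist_commute abs_minus_commute)
qed

theorem lemma5p1:
  fixes N :: nat and T \<gamma> :: real
    and X :: "real \<Rightarrow> ('d::finite) functional set"
    and \<tau> :: "('v::finite) rtree"
  assumes "N \<ge> 1" and "T > 0"
    and "1 / (real N + 1) < \<gamma>" and "\<gamma> \<le> 1 / real N"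
    and "branched_rough_path \<gamma> N T X"
    and "enumerated_shape \<tau>" and "tree_size \<tau> \<le> N"
    and "\<And>t \<sigma>. t \<in> {0..T} \<Longrightarrow> tree_size \<sigma> \<le> tree_size \<tau> div 2 \<Longrightarrow> pairing (X t) {#\<sigma>#} = 0"
  shows "\<exists>f :: real \<Rightarrow> real ^ ('v \<Rightarrow> 'd).
           holder_on (\<gamma> * tree_size \<tau>) {0..T} f \<and>
           (\<forall>s t. 0 \<le> s \<and> s < t \<and> t \<le> T \<longrightarrow> tensor_pairing (increment N X s t) \<tau> = f t - f s)"
proof (intro exI conjI allI impI)
  let ?f = "\<lambda>t. tensor_pairing (X t) \<tau>"
  have carrier: "X t \<in> carrier (trunc_group N)" if "t \<in> {0..T}" for t
    using assms(5) that by (auto simp: branched_rough_path_def)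
  have coord: "pairing (increment N X s t) {#map_rtree a \<tau>#} =
      pairing (X t) {#map_rtree a \<tau>#} - pairing (X s) {#map_rtree a \<tau>#}"
    if "0 \<le> s" "s < t" "t \<le> T" for s t a
  proof (rule increment_on_tree)
    show "X s \<in> carrier (trunc_group N)" "X t \<in> carrier (trunc_group N)"
      using that by (auto intro: carrier)
    show "pairing (X r) {#\<sigma>#} = 0" if "r \<in> {s, t}" "tree_size \<sigma> \<le> tree_size \<tau> div 2" for r \<sigma>
      using that \<open>0 \<le> s\<close> \<open>s < t\<close> \<open>t \<le> T\<close> by (intro assms(8)) auto
  qed (use assms(7) in \<open>auto simp: tree_size_map_rtree\<close>)
  show additive: "tensor_pairing (increment N X s t) \<tau> = ?f t - ?f s"
    if "0 \<le> s \<and> s < t \<and> t \<le> T" for s t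
    using that by (simp add: tensor_pairing_def vec_eq_iff coord)
  have "\<exists>C. \<forall>s t. 0 \<le> s \<and> s < t \<and> t \<le> T \<longrightarrow>
      \<bar>pairing (increment N X s t) {#map_rtree a \<tau>#}\<bar> \<le> C * \<bar>t - s\<bar> powr (\<gamma> * tree_size \<tau>)" for a
    using branched_rough_path_bound[OF assms(5), of "{#map_rtree a \<tau>#}"] assms(7)
    by (simp add: tree_size_map_rtree)
  then have "\<exists>C. \<forall>a s t. 0 \<le> s \<and> s < t \<and> t \<le> T \<longrightarrow>
      \<bar>pairing (increment N X s t) {#map_rtree a \<tau>#}\<bar> \<le> C a * \<bar>t - s\<bar> powr (\<gamma> * tree_size \<tau>)"
    by (intro choice allI)
  then obtain C where C: "\<And>a s t. 0 \<le> s \<and> s < t \<and> t \<le> T \<Longrightarrow>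
      \<bar>pairing (increment N X s t) {#map_rtree a \<tau>#}\<bar> \<le> C a * \<bar>t - s\<bar> powr (\<gamma> * tree_size \<tau>)"
    by blast
  show "holder_on (\<gamma> * tree_size \<tau>) {0..T} ?f"
  proof (rule holder_on_if_increasing_bound)
    fix s t assume "s \<in> {0..T}" "t \<in> {0..T}" "s < t"
    then have st: "0 \<le> s \<and> s < t \<and> t \<le> T" by auto
    have "dist (?f s) (?f t) = norm (tensor_pairing (increment N X s t) \<tau>)"
      by (simp add: additive[OF st] dist_norm norm_minus_commute)
    also have "\<dots> \<le> (\<Sum>a\<in>UNIV. \<bar>pairing (increment N X s t) {#map_rtree a \<tau>#}\<bar>)"
      using norm_le_l1_cart[of "tensor_pairing (increment N X s t) \<tau>"] by (simp add: tensor_pairing_def)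
    also have "\<dots> \<le> (\<Sum>a\<in>UNIV. C a * \<bar>t - s\<bar> powr (\<gamma> * tree_size \<tau>))"
      by (intro sum_mono C st)
    finally show "dist (?f s) (?f t) \<le> (\<Sum>a\<in>UNIV. C a) * \<bar>t - s\<bar> powr (\<gamma> * tree_size \<tau>)"
      by (simp add: sum_distrib_right)
  qed
qed

end
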